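(* Let $p>N$ and $1<t<p/N$. There exists a constant $C(p,t,N)>0$ depending only on $p$, $t$ and $N$ such that the following holds. Let $\Omega\subset\mathbb{R}^N$ be an open set, let $v\in A_t(\mathbb{R}^N)$ with $v\ge 0$, let $w\in A_t(\mathbb{R}^N)$, and define $$g(r_\Omega)=\sup_{x\in\Omega}\int_{B(x,r_\Omega)} v^{-\frac{1}{t-1}}(z)\,dz .$$ Let $u\in W^{1,p}_0(\Omega)$ be a nontrivial (weak) solution of $$-\operatorname{div}\big(v(x)|\nabla u|^{p-2}\nabla u\big)=w(x)|u|^{p-2}u\ \text{ in }\Omega,\qquad u=0\ \text{ on }\partial\Omega .$$ Then $$1\le C(p,t,N)\; r_\Omega^{\,p-tN}\; g(r_\Omega)^{t-1}\int_\Omega w(z)\,dz .$$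
   Context: $N$ is the space dimension. $B(x,r)$ is the open ball of center $x$ and radius $r$. For $1<t<\infty$, the Muckenhoupt class $A_t=A_t(\mathbb{R}^N)$ is the set of nonnegative $v\in L^1_{loc}(\mathbb{R}^N)$ for which there is a constant $c_{t,v}$ with $$\Big(\int_B v\,dx\Big)\Big(\int_B v^{-\frac{1}{t-1}}dx\Big)^{t-1}\le c_{t,v}|B|^t$$ for every ball $B\subset\mathbb{R}^N$. The inner radius of $\Omega$ is $r_\Omega=\sup_{x\in\Omega}d_\Omega(x)$, where $d_\Omega(x)=\inf_{y\in\partial\Omega}|x-y|$. A function $u$ is a (weak) solution if $\int_\Omega v|\nabla u|^{p-2}\nabla u\cdot\nabla\varphi\,dx=\int_\Omega w|u|^{p-2}u\,\varphi\,dx$ (all integrals being finite) for every $\varphi\in W^{1,p}_0(\Omega)$; nontrivial means $u\not\equiv0$. *)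

theory Defs
  imports "HOL-Analysis.Analysis"
begin

text \<open>Functions on \<open>\<real>\<^sup>N\<close> are Lebesgue measurable and considered up to null sets.
  Integrals whose value may be infinite are taken in \<^typ>\<open>ennreal\<close>.\<close>

section \<open>Powers, balls and inner radius with extended values\<close>

text \<open>Real powers on \<open>[0,\<infinity>]\<close>. Negative powers of \<open>0\<close> are \<open>\<infinity>\<close> (unlike \<^term>\<open>0 powr a = (0::real)\<close>)
  and negative powers of \<open>\<infinity>\<close> are \<open>0\<close>.\<close>

definition epowr :: "ennreal \<Rightarrow> real \<Rightarrow> ennreal" where
  "epowr x a =
    (if a = 0 then 1
     else if x = 0 then (if a < 0 then \<infinity> else 0)
     else if x = \<infinity> then (if a < 0 then 0 else \<infinity>)
     else ennreal (enn2real x powr a))"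

text \<open>Open ball whose radius may be infinite, in which case it is the whole space.\<close>

definition eball :: "'a::metric_space \<Rightarrow> ennreal \<Rightarrow> 'a set" where
  "eball x r = {y. ennreal (dist x y) < r}"

text \<open>For \<open>\<Omega> = \<real>\<^sup>N\<close> the boundary is empty and the distance to it is \<open>inf \<emptyset> = \<infinity>\<close>.\<close>

definition bdry_dist :: "'a::metric_space set \<Rightarrow> 'a \<Rightarrow> ennreal" where
  "bdry_dist \<Omega> x = (INF y\<in>frontier \<Omega>. ennreal (dist x y))"

definition inner_radius :: "'a::metric_space set \<Rightarrow> ennreal" where
  "inner_radius \<Omega> = (SUP x\<in>\<Omega>. bdry_dist \<Omega> x)"

section \<open>Muckenhoupt weights\<close>

text \<open>The integrals of \<open>v powr (-1/(t-1))\<close> over balls are required to be finite, so that the product in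
  the Muckenhoupt condition never has the form \<open>0 \<cdot> \<infinity>\<close>. This excludes exactly \<open>v = 0\<close> a.e.:
  if \<open>v\<close> is not a.e. zero, the product being finite on all balls already forces finiteness.\<close>

definition muckenhoupt :: "real \<Rightarrow> ('a::euclidean_space \<Rightarrow> real) set" where
  "muckenhoupt t = {v.
     (AE x in lebesgue. 0 \<le> v x) \<and>
     (\<forall>K. compact K \<longrightarrow> v absolutely_integrable_on K) \<and>
     (\<forall>x r. 0 < r \<longrightarrow>
        (\<integral>\<^sup>+z\<in>ball x r. epowr (ennreal (v z)) (- 1 / (t - 1)) \<partial>lebesgue) < \<infinity>) \<and>
     (\<exists>c::real. \<forall>x r. 0 < r \<longrightarrow>
        (\<integral>\<^sup>+z\<in>ball x r. ennreal (v z) \<partial>lebesgue) *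
        epowr (\<integral>\<^sup>+z\<in>ball x r. epowr (ennreal (v z)) (- 1 / (t - 1)) \<partial>lebesgue) (t - 1)
        \<le> ennreal c * epowr (emeasure lebesgue (ball x r)) t)}"

section \<open>Sobolev spaces\<close>

fun C_k :: "nat \<Rightarrow> ('a::euclidean_space \<Rightarrow> real) \<Rightarrow> bool" where
  "C_k 0 f \<longleftrightarrow> continuous_on UNIV f"
| "C_k (Suc k) f \<longleftrightarrow>
     (\<forall>x. f differentiable (at x)) \<and>
     (\<forall>b\<in>Basis. C_k k (\<lambda>x. frechet_derivative f (at x) b))"

definition test_functions :: "'a::euclidean_space set \<Rightarrow> ('a \<Rightarrow> real) set" where
  "test_functions \<Omega> =
     {\<phi>. (\<forall>k. C_k k \<phi>) \<and> compact (closure {x. \<phi> x \<noteq> 0}) \<and> closure {x. \<phi> x \<noteq> 0} \<subseteq> \<Omega>}"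

definition grad :: "('a::euclidean_space \<Rightarrow> real) \<Rightarrow> 'a \<Rightarrow> 'a" where
  "grad f x = (\<Sum>b\<in>Basis. frechet_derivative f (at x) b *\<^sub>R b)"

definition Lp :: "real \<Rightarrow> 'a::euclidean_space set \<Rightarrow> ('a \<Rightarrow> 'b::euclidean_space) set" where
  "Lp p \<Omega> = {f. f \<in> borel_measurable (lebesgue_on \<Omega>) \<and>
                (\<lambda>x. norm (f x) powr p) absolutely_integrable_on \<Omega>}"

definition has_weak_gradient ::
    "'a::euclidean_space set \<Rightarrow> ('a \<Rightarrow> real) \<Rightarrow> ('a \<Rightarrow> 'a) \<Rightarrow> bool" where
  "has_weak_gradient \<Omega> u G \<longleftrightarrow>
     (\<forall>K. compact K \<and> K \<subseteq> \<Omega> \<longrightarrow> u absolutely_integrable_on K \<and> G absolutely_integrable_on K) \<and>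
     (\<forall>\<phi>\<in>test_functions \<Omega>.
        (LINT x:\<Omega>|lebesgue. u x *\<^sub>R grad \<phi> x) = - (LINT x:\<Omega>|lebesgue. \<phi> x *\<^sub>R G x))"

text \<open>The weak gradient is unique up to null sets of \<open>\<Omega>\<close> whenever it exists; its values outside \<open>\<Omega>\<close>
  are irrelevant.\<close>

definition wgrad :: "'a::euclidean_space set \<Rightarrow> ('a \<Rightarrow> real) \<Rightarrow> 'a \<Rightarrow> 'a" where
  "wgrad \<Omega> u = (SOME G. has_weak_gradient \<Omega> u G)"

definition W1p :: "real \<Rightarrow> 'a::euclidean_space set \<Rightarrow> ('a \<Rightarrow> real) set" where
  "W1p p \<Omega> = {u. u \<in> Lp p \<Omega> \<and> has_weak_gradient \<Omega> u (wgrad \<Omega> u) \<and> wgrad \<Omega> u \<in> Lp p \<Omega>}"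

text \<open>The closure of \<open>C\<^sub>c\<^sup>\<infinity>(\<Omega>)\<close> in \<open>W\<^sup>1\<^sup>,\<^sup>p(\<Omega>)\<close>.\<close>

definition W1p0 :: "real \<Rightarrow> 'a::euclidean_space set \<Rightarrow> ('a \<Rightarrow> real) set" where
  "W1p0 p \<Omega> = {u \<in> W1p p \<Omega>. \<exists>\<phi>::nat \<Rightarrow> 'a \<Rightarrow> real.
     (\<forall>n. \<phi> n \<in> test_functions \<Omega>) \<and>
     (\<lambda>n. \<integral>\<^sup>+x\<in>\<Omega>. ennreal (\<bar>\<phi> n x - u x\<bar> powr p) \<partial>lebesgue) \<longlonglongrightarrow> 0 \<and>
     (\<lambda>n. \<integral>\<^sup>+x\<in>\<Omega>. ennreal (norm (grad (\<phi> n) x - wgrad \<Omega> u x) powr p) \<partial>lebesgue) \<longlonglongrightarrow> 0}"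

section \<open>Weak solutions\<close>

text \<open>The Dirichlet condition is expressed by \<^term>\<open>u \<in> W1p0 p \<Omega>\<close>. For \<open>p < 2\<close>, the expressions
  \<open>|\<xi>|\<^sup>p\<^sup>-\<^sup>2 \<xi>\<close> are \<open>0\<close> at \<open>\<xi> = 0\<close>, as usual.\<close>

definition weak_solution ::
    "real \<Rightarrow> 'a::euclidean_space set \<Rightarrow> ('a \<Rightarrow> real) \<Rightarrow> ('a \<Rightarrow> real) \<Rightarrow> ('a \<Rightarrow> real) \<Rightarrow> bool" where
  "weak_solution p \<Omega> v w u \<longleftrightarrow>
     u \<in> W1p0 p \<Omega> \<and>
     (\<forall>\<phi>\<in>W1p0 p \<Omega>.
        set_integrable lebesgue \<Omega>
          (\<lambda>x. v x * norm (wgrad \<Omega> u x) powr (p - 2) * (wgrad \<Omega> u x \<bullet> wgrad \<Omega> \<phi> x)) \<and>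
        set_integrable lebesgue \<Omega> (\<lambda>x. w x * \<bar>u x\<bar> powr (p - 2) * u x * \<phi> x) \<and>
        (LINT x:\<Omega>|lebesgue. v x * norm (wgrad \<Omega> u x) powr (p - 2) * (wgrad \<Omega> u x \<bullet> wgrad \<Omega> \<phi> x))
          = (LINT x:\<Omega>|lebesgue. w x * \<bar>u x\<bar> powr (p - 2) * u x * \<phi> x))"

definition dual_weight_sup ::
    "real \<Rightarrow> 'a::euclidean_space set \<Rightarrow> ('a \<Rightarrow> real) \<Rightarrow> ennreal \<Rightarrow> ennreal" where
  "dual_weight_sup t \<Omega> v r =
     (SUP x\<in>\<Omega>. \<integral>\<^sup>+z\<in>eball x r. epowr (ennreal (v z)) (- 1 / (t - 1)) \<partial>lebesgue)"

end

theory Submission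
  imports Defs
begin

text \<open>Put \<open>s = p/t > N\<close>. If \<open>x \<in> \<Omega>\<close> has a nearest boundary point \<open>y\<close> at distance \<open>d\<close>, then Morrey's
  inequality with exponent \<open>s\<close> on \<open>B(x,d) \<subseteq> \<Omega>\<close>, applied to functions vanishing at \<open>y\<close>, bounds
  \<open>|u(x)|\<^sup>s\<close> by \<open>M d\<^sup>s\<^sup>-\<^sup>N \<integral> |\<nabla>u|\<^sup>s\<close> for almost every \<open>x\<close>; the inequality passes from test functions to \<open>u\<close>
  because \<open>L\<^sup>p\<close> convergence on a ball implies \<open>L\<^sup>s\<close> convergence. Hoelder's inequality with exponents \<open>t\<close>
  and \<open>t/(t-1)\<close> then gives \<open>|u|\<^sup>p \<le> \<kappa> I\<close> almost everywhere, where \<open>I = \<integral> v|\<nabla>u|\<^sup>p\<close> and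
  \<open>\<kappa> = M\<^sup>t r\<^sub>\<Omega>\<^sup>p\<^sup>-\<^sup>t\<^sup>N g(r\<^sub>\<Omega>)\<^sup>t\<^sup>-\<^sup>1\<close>. Testing the equation with \<open>u\<close> yields \<open>I = \<integral> w|u|\<^sup>p \<le> \<kappa> I \<integral> w\<close>, and
  \<open>0 < I < \<infinity>\<close>.\<close>

section \<open>Hoelder's inequality for nonnegative integrals\<close>

text \<open>Young's inequality is applied to \<open>f / \<alpha>\<close> and
  \<open>g / \<beta>\<close>, normalised by the roots of the bounds, and then integrated. Real
  bounds \<open>A\<close> and \<open>B\<close> stand in for the norms, so that no roots of extended
  numbers occur. The normalisation divides by the roots, so the cases \<open>A = 0\<close> and
  \<open>B = 0\<close> are separate: there one factor vanishes almost everywhere.\<close>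

lemma nn_integral_Holder:
  fixes f g :: "'a \<Rightarrow> real"
  assumes pq: "1 < p" "1 < q" "1 / p + 1 / q = 1"
    and [measurable]: "f \<in> borel_measurable M" "g \<in> borel_measurable M"
    and nonneg: "\<And>x. 0 \<le> f x" "\<And>x. 0 \<le> g x"
    and A: "(\<integral>\<^sup>+x. ennreal (f x powr p) \<partial>M) \<le> ennreal A" "0 \<le> A"
    and B: "(\<integral>\<^sup>+x. ennreal (g x powr q) \<partial>M) \<le> ennreal B" "0 \<le> B"
  shows "(\<integral>\<^sup>+x. ennreal (f x * g x) \<partial>M) \<le> ennreal (A powr (1 / p) * B powr (1 / q))"
proof -
  have null: "AE x in M. h x = 0"
    if "(\<integral>\<^sup>+x. ennreal (h x powr r) \<partial>M) = 0" "h \<in> borel_measurable M" for h :: "'a \<Rightarrow> real" and r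
  proof -
    from that have [measurable]: "h \<in> borel_measurable M" by simp
    from that(1) have "AE x in M. ennreal (h x powr r) = 0"
      by (subst (asm) nn_integral_0_iff_AE) auto
    then show ?thesis by eventually_elim auto
  qed
  have zero: "(\<integral>\<^sup>+x. ennreal (f x * g x) \<partial>M) = 0" if "AE x in M. f x * g x = 0"
    using that by (subst nn_integral_0_iff_AE) auto
  consider "A = 0" | "B = 0" | "0 < A" "0 < B" using A(2) B(2) by linarith
  then show ?thesis
  proof cases
    case 1
    then have "AE x in M. f x = 0" using A by (intro null[of f p]) auto
    then have "AE x in M. f x * g x = 0" by eventually_elim simp
    then show ?thesis by (simp add: zero)
  next
    case 2
    then have "AE x in M. g x = 0" using B by (intro null[of g q]) auto
    then have "AE x in M. f x * g x = 0" by eventually_elim simp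
    then show ?thesis by (simp add: zero)
  next
    case 3
    define \<alpha> \<beta> where "\<alpha> = A powr (1 / p)" and "\<beta> = B powr (1 / q)"
    have pos: "0 < \<alpha>" "0 < \<beta>" and pw: "\<alpha> powr p = A" "\<beta> powr q = B"
      using 3 pq by (auto simp: \<alpha>_def \<beta>_def powr_powr)
    \<comment> \<open>These are the weights left on the two powers once Young's inequality is
      multiplied by \<open>\<alpha> * \<beta>\<close>. They give
      \<open>a * A + b * B = \<alpha> * \<beta>\<close> because the exponents are conjugate.\<close>
    define a b where "a = \<alpha> * \<beta> / (p * A)" and "b = \<alpha> * \<beta> / (q * B)"
    have ab: "0 \<le> a" "0 \<le> b" using pos 3 pq by (auto simp: a_def b_def)
    have pt: "f x * g x \<le> a * f x powr p + b * g x powr q" for x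
    proof -
      have "f x / \<alpha> * (g x / \<beta>) \<le> (f x / \<alpha>) powr p / p + (g x / \<beta>) powr q / q"
        using nonneg pos pq by (intro Youngs_inequality) auto
      then have "\<alpha> * \<beta> * (f x / \<alpha> * (g x / \<beta>)) \<le>
          \<alpha> * \<beta> * ((f x / \<alpha>) powr p / p + (g x / \<beta>) powr q / q)"
        using pos by (intro mult_left_mono) auto
      then show ?thesis
        using pos nonneg by (simp add: powr_divide pw a_def b_def field_simps)
    qed
    have "(\<integral>\<^sup>+x. ennreal (f x * g x) \<partial>M)
        \<le> (\<integral>\<^sup>+x. ennreal a * ennreal (f x powr p) + ennreal b * ennreal (g x powr q) \<partial>M)"
      using pt ab by (intro nn_integral_mono) (auto simp flip: ennreal_mult ennreal_plus intro!: ennreal_leI)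
    also have "\<dots> = ennreal a * (\<integral>\<^sup>+x. ennreal (f x powr p) \<partial>M)
        + ennreal b * (\<integral>\<^sup>+x. ennreal (g x powr q) \<partial>M)"
      by (simp add: nn_integral_add nn_integral_cmult)
    also have "\<dots> \<le> ennreal a * ennreal A + ennreal b * ennreal B"
      using A B by (intro add_mono mult_left_mono) auto
    also have "\<dots> = ennreal (a * A + b * B)"
      using A B ab by (simp flip: ennreal_mult ennreal_plus)
    also have "a * A + b * B = \<alpha> * \<beta> * (1 / p + 1 / q)"
      using 3 by (simp add: a_def b_def field_simps)
    finally show ?thesis using pq by (simp add: \<alpha>_def \<beta>_def)
  qed
qed

section \<open>Morrey's inequality on balls\<close>

lemma nn_integral_lborel_affine:
  fixes f :: "'a::euclidean_space \<Rightarrow> ennreal"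
  assumes [measurable]: "f \<in> borel_measurable borel" and "c \<noteq> 0"
  shows "(\<integral>\<^sup>+x. f x \<partial>lborel) = ennreal (\<bar>c\<bar> ^ DIM('a)) * (\<integral>\<^sup>+x. f (t + c *\<^sub>R x) \<partial>lborel)"
  by (subst lborel_affine[OF \<open>c \<noteq> 0\<close>, of t])
     (simp add: nn_integral_density nn_integral_distr nn_integral_cmult ennreal_power)

text \<open>Convexity, with a centre \<open>a\<close> that may lie on the sphere, as a nearest
  boundary point does. Strictness comes from \<open>z\<close> alone, which is why
  \<open>\<tau>\<close> must be positive.\<close>

lemma segment_in_ball:
  fixes a c z :: "'a::euclidean_space"
  assumes "a \<in> cball c d" "z \<in> ball c d" "0 < \<tau>" "\<tau> \<le> 1"
  shows "a + \<tau> *\<^sub>R (z - a) \<in> ball c d"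
proof (cases "\<tau> = 1")
  case False
  have "norm ((1 - \<tau>) *\<^sub>R (a - c) + \<tau> *\<^sub>R (z - c)) \<le> (1 - \<tau>) * norm (a - c) + \<tau> * norm (z - c)"
    using assms by (intro norm_triangle_le) auto
  also have "\<dots> < (1 - \<tau>) * d + \<tau> * d"
    using assms False
    by (intro add_le_less_mono mult_left_mono mult_strict_left_mono) (auto simp: dist_norm norm_minus_commute)
  finally have "norm ((1 - \<tau>) *\<^sub>R (a - c) + \<tau> *\<^sub>R (z - c)) < d" by (simp add: algebra_simps)
  moreover have "(1 - \<tau>) *\<^sub>R (a - c) + \<tau> *\<^sub>R (z - c) = a + \<tau> *\<^sub>R (z - a) - c"
    by (simp add: algebra_simps)
  ultimately show ?thesis by (simp add: dist_norm norm_minus_commute)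
qed (use assms in auto)

text \<open>The homothety of ratio \<open>\<tau>\<close> about \<open>a\<close> keeps the ball
  inside itself, and its Jacobian is \<open>\<tau>\<close> to the power of the dimension.\<close>

lemma nn_integral_ball_contract:
  fixes h :: "'a::euclidean_space \<Rightarrow> ennreal"
  assumes [measurable]: "h \<in> borel_measurable borel" and a: "a \<in> cball c d" and \<tau>: "0 < \<tau>" "\<tau> \<le> 1"
  shows "(\<integral>\<^sup>+z\<in>ball c d. h (a + \<tau> *\<^sub>R (z - a)) \<partial>lborel)
    \<le> ennreal (\<tau> powr (- real DIM('a))) * (\<integral>\<^sup>+z\<in>ball c d. h z \<partial>lborel)"
proof -
  have "(\<integral>\<^sup>+z\<in>ball c d. h (a + \<tau> *\<^sub>R (z - a)) \<partial>lborel)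
      \<le> (\<integral>\<^sup>+z. h (a + \<tau> *\<^sub>R (z - a)) * indicator (ball c d) (a + \<tau> *\<^sub>R (z - a)) \<partial>lborel)"
    using segment_in_ball[OF a _ \<tau>] by (intro nn_integral_mono) (auto simp: indicator_def)
  \<comment> \<open>Inserting a factor 1 makes the Jacobian available for the change of variables
    that follows.\<close>
  also have "\<dots> = ennreal (\<tau> powr (- real DIM('a))) * (ennreal (\<tau> ^ DIM('a)) * \<dots>)"
    using \<tau> by (simp add: powr_minus powr_realpow ennreal_mult[symmetric] mult.assoc[symmetric])
  also have "ennreal (\<tau> ^ DIM('a)) *
      (\<integral>\<^sup>+z. h (a + \<tau> *\<^sub>R (z - a)) * indicator (ball c d) (a + \<tau> *\<^sub>R (z - a)) \<partial>lborel)
      = (\<integral>\<^sup>+z\<in>ball c d. h z \<partial>lborel)"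
  proof -
    have "(\<lambda>z. h z * indicator (ball c d) z) \<in> borel_measurable borel"
      by (intro borel_measurable_times_ennreal borel_measurable_indicator) auto
    \<comment> \<open>The homothety is the affine map with ratio \<open>\<tau>\<close> and
      translation vector \<open>a - \<tau> *\<^sub>R a\<close>.\<close>
    from nn_integral_lborel_affine[OF this, of \<tau> "a - \<tau> *\<^sub>R a"] \<tau> show ?thesis
      by (simp add: algebra_simps)
  qed
  finally show ?thesis .
qed

lemma nn_integral_powr_01:
  fixes a :: real
  assumes "a < 1"
  shows "(\<integral>\<^sup>+x\<in>{0..1}. ennreal (x powr (- a)) \<partial>lborel) = ennreal (1 / (1 - a))"
proof -
  have "((\<lambda>x. x powr (- a)) has_integral (1 powr (- a + 1) / (- a + 1))) {0..1::real}"
    using assms by (intro has_integral_powr_from_0) auto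
  from nn_integral_has_integral_lebesgue[OF _ this]
  have "(\<integral>\<^sup>+x. ennreal (indicator {0..1} x * x powr (- a)) \<partial>lborel) = ennreal (1 / (1 - a))"
    by simp
  moreover have "ennreal (x powr (- a)) * indicator {0..1} x = ennreal (indicator {0..1} x * x powr (- a))"
    for x :: real
    by (auto simp: indicator_def)
  ultimately show ?thesis by simp
qed

lemma frechet_derivative_grad:
  fixes f :: "'a::euclidean_space \<Rightarrow> real"
  assumes "f differentiable (at x)"
  shows "frechet_derivative f (at x) h = grad f x \<bullet> h"
proof -
  have lin: "linear (frechet_derivative f (at x))"
    using assms by (rule linear_frechet_derivative)
  have "frechet_derivative f (at x) h = frechet_derivative f (at x) (\<Sum>b\<in>Basis. (h \<bullet> b) *\<^sub>R b)"
    by (simp add: euclidean_representation)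
  also have "\<dots> = (\<Sum>b\<in>Basis. (h \<bullet> b) * frechet_derivative f (at x) b)"
    using lin by (simp add: linear_sum linear_scale)
  also have "\<dots> = grad f x \<bullet> h"
    by (simp add: grad_def inner_sum_left inner_commute[of h] mult.commute)
  finally show ?thesis .
qed

text \<open>The fundamental theorem of calculus along the segment, followed by Cauchy-Schwarz. The
  bound is a nonnegative integral so that Tonelli's theorem can be applied to it later.\<close>

lemma segment_increment_le:
  fixes f :: "'a::euclidean_space \<Rightarrow> real"
  assumes diff: "\<And>x. f differentiable (at x)" and cont: "continuous_on UNIV (grad f)"
  shows "ennreal \<bar>f a - f z\<bar>
    \<le> ennreal (norm (z - a)) * (\<integral>\<^sup>+\<tau>\<in>{0..1}. ennreal (norm (grad f (a + \<tau> *\<^sub>R (z - a)))) \<partial>lborel)"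
proof -
  define \<gamma> where "\<gamma> = (\<lambda>\<tau>::real. a + \<tau> *\<^sub>R (z - a))"
  have contg: "continuous_on S (\<lambda>\<tau>. grad f (\<gamma> \<tau>))" for S
    unfolding \<gamma>_def by (intro continuous_on_compose2[OF cont] continuous_intros) auto
  have "((\<lambda>\<tau>. f (\<gamma> \<tau>)) has_vector_derivative (grad f (\<gamma> \<tau>) \<bullet> (z - a))) (at \<tau> within {0..1})" for \<tau>
  proof -
    have "(f has_derivative frechet_derivative f (at (\<gamma> \<tau>))) (at (\<gamma> \<tau>))"
      using diff frechet_derivative_works by blast
    moreover have "(\<gamma> has_derivative (\<lambda>h. h *\<^sub>R (z - a))) (at \<tau> within {0..1})"
      unfolding \<gamma>_def by (auto intro!: derivative_eq_intros)
    ultimately have "((f \<circ> \<gamma>) has_derivative frechet_derivative f (at (\<gamma> \<tau>)) \<circ> (\<lambda>h. h *\<^sub>R (z - a)))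
        (at \<tau> within {0..1})"
      using diff_chain_within has_derivative_at_withinI by blast
    then show ?thesis
      by (simp add: has_vector_derivative_def o_def frechet_derivative_grad[OF diff])
  qed
  then have "((\<lambda>\<tau>. grad f (\<gamma> \<tau>) \<bullet> (z - a)) has_integral (f (\<gamma> 1) - f (\<gamma> 0))) {0..1}"
    by (intro fundamental_theorem_of_calculus) auto
  then have I: "integral {0..1} (\<lambda>\<tau>. grad f (\<gamma> \<tau>) \<bullet> (z - a)) = f z - f a"
    by (simp add: integral_unique \<gamma>_def)
  have ci: "(\<lambda>\<tau>. norm (grad f (\<gamma> \<tau>))) integrable_on {0..1}"
    by (intro integrable_continuous_interval continuous_intros contg)
  have "\<bar>f a - f z\<bar> = norm (integral {0..1} (\<lambda>\<tau>. grad f (\<gamma> \<tau>) \<bullet> (z - a)))"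
    by (simp add: I)
  also have "\<dots> \<le> integral {0..1} (\<lambda>\<tau>. norm (z - a) * norm (grad f (\<gamma> \<tau>)))"
    using Cauchy_Schwarz_ineq2
    by (intro integral_norm_bound_integral integrable_continuous_interval continuous_intros contg)
      (auto simp: mult.commute[of "norm (z - a)"])
  also have "\<dots> = norm (z - a) * integral {0..1} (\<lambda>\<tau>. norm (grad f (\<gamma> \<tau>)))"
    by simp
  finally have "\<bar>f a - f z\<bar> \<le> norm (z - a) * integral {0..1} (\<lambda>\<tau>. norm (grad f (\<gamma> \<tau>)))" .
  moreover have "(\<integral>\<^sup>+\<tau>\<in>{0..1}. ennreal (norm (grad f (\<gamma> \<tau>))) \<partial>lborel)
      = ennreal (integral {0..1} (\<lambda>\<tau>. norm (grad f (\<gamma> \<tau>))))"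
  proof -
    have "((\<lambda>\<tau>. norm (grad f (\<gamma> \<tau>))) has_integral integral {0..1} (\<lambda>\<tau>. norm (grad f (\<gamma> \<tau>)))) {0..1}"
      using ci by (rule integrable_integral)
    from nn_integral_has_integral_lebesgue[OF _ this]
    have "(\<integral>\<^sup>+\<tau>. ennreal (indicator {0..1} \<tau> * norm (grad f (\<gamma> \<tau>))) \<partial>lborel)
        = ennreal (integral {0..1} (\<lambda>\<tau>. norm (grad f (\<gamma> \<tau>))))"
      by simp
    moreover have "ennreal (norm (grad f (\<gamma> \<tau>))) * indicator {0..1} \<tau>
        = ennreal (indicator {0..1} \<tau> * norm (grad f (\<gamma> \<tau>)))" for \<tau>
      by (auto simp: indicator_def)
    ultimately show ?thesis by simp
  qed
  moreover have "0 \<le> integral {0..1} (\<lambda>\<tau>. norm (grad f (\<gamma> \<tau>)))"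
    using ci by (intro integral_nonneg) auto
  ultimately show ?thesis
    unfolding \<gamma>_def[symmetric] by (simp flip: ennreal_mult add: ennreal_leI \<gamma>_def)
qed

text \<open>Integrating the increments along segments from \<^term>\<open>a\<close>, the homothety of ratio \<open>\<tau>\<close> centred at
  \<^term>\<open>a\<close> maps the ball into itself and costs a factor \<open>\<tau> powr (- N / s)\<close> in the \<open>L\<^sup>s\<close> norm of the gradient,
  which is integrable on \<open>(0,1)\<close> since \<open>s > N\<close>.\<close>

lemma nn_integral_ball_oscillation:
  fixes f :: "'a::euclidean_space \<Rightarrow> real"
  assumes diff: "\<And>x. f differentiable (at x)" and cont: "continuous_on UNIV (grad f)"
    and s: "real DIM('a) < s" and a: "a \<in> cball c d" and d: "0 < d"
    and A: "(\<integral>\<^sup>+z\<in>ball c d. ennreal (norm (grad f z) powr s) \<partial>lborel) \<le> ennreal A" "0 \<le> A"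
  shows "(\<integral>\<^sup>+z\<in>ball c d. ennreal \<bar>f a - f z\<bar> \<partial>lborel)
    \<le> ennreal (2 * d / (1 - real DIM('a) / s) * A powr (1 / s) * measure lborel (ball c d) powr (1 - 1 / s))"
proof -
  let ?n = "real DIM('a)"
  define \<mu> where "\<mu> = measure lborel (ball c d)"
  have \<mu>: "emeasure lborel (ball c d) = ennreal \<mu>" "0 \<le> \<mu>"
    unfolding \<mu>_def using emeasure_lborel_ball_finite[of c d]
    by (auto intro!: emeasure_eq_ennreal_measure)
  have n1: "1 \<le> ?n" by (simp add: Suc_leI)
  have s1: "1 < s" "0 < s" using s n1 by linarith+
  \<comment> \<open>The exponent conjugate to \<open>s\<close>; Hoelder's inequality below pairs the
    gradient with the indicator of the ball.\<close>
  define q where "q = s / (s - 1)"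
  have q: "1 < q" "1 / q = 1 - 1 / s" using s1 by (auto simp: q_def field_simps)
  have [measurable]: "ball c d \<in> sets borel" by simp
  have [measurable]: "grad f \<in> borel_measurable borel"
    using cont by (rule borel_measurable_continuous_onI)
  have [measurable]: "f \<in> borel_measurable borel"
    using diff differentiable_imp_continuous_on[of f UNIV]
    by (intro borel_measurable_continuous_onI) (auto simp: differentiable_on_def)
  define B where "B = A powr (1 / s) * \<mu> powr (1 - 1 / s)"
  have B0: "0 \<le> B" by (simp add: B_def)
  have inner: "(\<integral>\<^sup>+z\<in>ball c d. ennreal (norm (grad f (a + \<tau> *\<^sub>R (z - a)))) \<partial>lborel)
      \<le> ennreal (\<tau> powr (- (?n / s)) * B)" if \<tau>: "0 < \<tau>" "\<tau> \<le> 1" for \<tau>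
  proof -
    have "(\<integral>\<^sup>+z\<in>ball c d. ennreal (norm (grad f (a + \<tau> *\<^sub>R (z - a)))) \<partial>lborel)
      = (\<integral>\<^sup>+z. ennreal ((norm (grad f (a + \<tau> *\<^sub>R (z - a))) * indicator (ball c d) z)
          * indicator (ball c d) z) \<partial>lborel)"
      by (intro nn_integral_cong) (auto simp: indicator_def)
    also have "\<dots> \<le> ennreal ((\<tau> powr (- ?n) * A) powr (1 / s) * \<mu> powr (1 / q))"
    proof (rule nn_integral_Holder)
      have "(\<integral>\<^sup>+z. ennreal ((norm (grad f (a + \<tau> *\<^sub>R (z - a))) * indicator (ball c d) z) powr s) \<partial>lborel)
        = (\<integral>\<^sup>+z\<in>ball c d. ennreal (norm (grad f (a + \<tau> *\<^sub>R (z - a))) powr s) \<partial>lborel)"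
        by (intro nn_integral_cong) (auto simp: indicator_def)
      also have "\<dots> \<le> ennreal (\<tau> powr (- ?n)) * (\<integral>\<^sup>+z\<in>ball c d. ennreal (norm (grad f z) powr s) \<partial>lborel)"
        using a \<tau> by (intro nn_integral_ball_contract) auto
      also have "\<dots> \<le> ennreal (\<tau> powr (- ?n)) * ennreal A"
        using A by (intro mult_left_mono) auto
      finally show "(\<integral>\<^sup>+z. ennreal ((norm (grad f (a + \<tau> *\<^sub>R (z - a))) * indicator (ball c d) z) powr s) \<partial>lborel)
        \<le> ennreal (\<tau> powr (- ?n) * A)" using A by (simp add: ennreal_mult)
      have "(\<integral>\<^sup>+z. ennreal (indicator (ball c d) z powr q) \<partial>lborel) = (\<integral>\<^sup>+z. indicator (ball c d) z \<partial>lborel)"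
        by (intro nn_integral_cong) (auto simp: indicator_def)
      also have "\<dots> = ennreal \<mu>" by (simp add: \<mu>)
      finally show "(\<integral>\<^sup>+z. ennreal (indicator (ball c d) z powr q) \<partial>lborel) \<le> ennreal \<mu>" by simp
    qed (use q s1 A \<mu> in auto)
    also have "(\<tau> powr (- ?n) * A) powr (1 / s) * \<mu> powr (1 / q) = \<tau> powr (- (?n / s)) * B"
      using A by (simp add: powr_mult powr_powr B_def q)
    finally show ?thesis .
  qed
  \<comment> \<open>The factor \<open>2 * d\<close> is the diameter of the ball and bounds the
    length of every segment from \<open>a\<close> to \<open>z\<close>.\<close>
  have "(\<integral>\<^sup>+z\<in>ball c d. ennreal \<bar>f a - f z\<bar> \<partial>lborel)
    \<le> (\<integral>\<^sup>+z. ennreal (2 * d) * (\<integral>\<^sup>+\<tau>. ennreal (norm (grad f (a + \<tau> *\<^sub>R (z - a))))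
        * indicator {0..1} \<tau> * indicator (ball c d) z \<partial>lborel) \<partial>lborel)"
  proof (rule nn_integral_mono)
    fix z
    show "ennreal \<bar>f a - f z\<bar> * indicator (ball c d) z \<le> ennreal (2 * d) *
      (\<integral>\<^sup>+\<tau>. ennreal (norm (grad f (a + \<tau> *\<^sub>R (z - a)))) * indicator {0..1} \<tau> * indicator (ball c d) z \<partial>lborel)"
    proof (cases "z \<in> ball c d")
      case True
      have "norm (z - a) \<le> dist c z + dist c a"
        by (metis dist_commute dist_norm dist_triangle2)
      then have "norm (z - a) \<le> 2 * d" using True a by simp
      then have "ennreal (norm (z - a)) * (\<integral>\<^sup>+\<tau>\<in>{0..1}. ennreal (norm (grad f (a + \<tau> *\<^sub>R (z - a)))) \<partial>lborel)
        \<le> ennreal (2 * d) * (\<integral>\<^sup>+\<tau>\<in>{0..1}. ennreal (norm (grad f (a + \<tau> *\<^sub>R (z - a)))) \<partial>lborel)"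
        by (intro mult_right_mono ennreal_leI) auto
      then show ?thesis using segment_increment_le[OF diff cont, of a z] True by auto
    qed simp
  qed
  also have "\<dots> = ennreal (2 * d) * (\<integral>\<^sup>+z. (\<integral>\<^sup>+\<tau>. ennreal (norm (grad f (a + \<tau> *\<^sub>R (z - a))))
        * indicator {0..1} \<tau> * indicator (ball c d) z \<partial>lborel) \<partial>lborel)"
    by (intro nn_integral_cmult) simp
  also have "(\<integral>\<^sup>+z. (\<integral>\<^sup>+\<tau>. ennreal (norm (grad f (a + \<tau> *\<^sub>R (z - a))))
        * indicator {0..1} \<tau> * indicator (ball c d) z \<partial>lborel) \<partial>lborel)
      = (\<integral>\<^sup>+\<tau>. (\<integral>\<^sup>+z. ennreal (norm (grad f (a + \<tau> *\<^sub>R (z - a))))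
        * indicator {0..1} \<tau> * indicator (ball c d) z \<partial>lborel) \<partial>lborel)"
    by (rule lborel_pair.Fubini') measurable
  also have "\<dots> \<le> (\<integral>\<^sup>+\<tau>. ennreal B * (ennreal (\<tau> powr (- (?n / s))) * indicator {0..1} \<tau>) \<partial>lborel)"
  proof (rule nn_integral_mono_AE)
    \<comment> \<open>The point 0 has to be discarded: there \<open>powr\<close> returns 0, so the
      right-hand side vanishes while the left-hand side may be positive.\<close>
    have "AE \<tau> in lborel. \<tau> \<noteq> (0::real)" by (rule AE_lborel_singleton)
    then show "AE \<tau> in lborel. (\<integral>\<^sup>+z. ennreal (norm (grad f (a + \<tau> *\<^sub>R (z - a))))
        * indicator {0..1} \<tau> * indicator (ball c d) z \<partial>lborel)
      \<le> ennreal B * (ennreal (\<tau> powr (- (?n / s))) * indicator {0..1} \<tau>)"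
    proof eventually_elim
      case (elim \<tau>)
      show ?case
      proof (cases "\<tau> \<in> {0..1}")
        case True
        then have "0 < \<tau>" "\<tau> \<le> 1" using elim by auto
        from inner[OF this] True B0 show ?thesis
          by (simp add: ennreal_mult mult.commute)
      qed simp
    qed
  qed
  also have "\<dots> = ennreal B * ennreal (1 / (1 - ?n / s))"
    using s s1 by (subst nn_integral_cmult) (auto simp: nn_integral_powr_01)
  finally have "(\<integral>\<^sup>+z\<in>ball c d. ennreal \<bar>f a - f z\<bar> \<partial>lborel)
      \<le> ennreal (2 * d) * (ennreal B * ennreal (1 / (1 - ?n / s)))"
    by (simp add: mult_left_mono)
  also have "\<dots> = ennreal (2 * d * (B * (1 / (1 - ?n / s))))"
  proof -
    have c: "0 \<le> 1 / (1 - ?n / s)" using s s1 by simp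
    then have "ennreal B * ennreal (1 / (1 - ?n / s)) = ennreal (B * (1 / (1 - ?n / s)))"
      using B0 by (intro ennreal_mult[symmetric])
    moreover have "ennreal (2 * d) * ennreal (B * (1 / (1 - ?n / s))) = ennreal (2 * d * (B * (1 / (1 - ?n / s))))"
      using d B0 c by (intro ennreal_mult[symmetric] mult_nonneg_nonneg) auto
    ultimately show ?thesis by simp
  qed
  finally show ?thesis by (simp add: B_def \<mu>_def mult_ac)
qed

text \<open>Both \<open>f x\<close> and \<open>f y\<close> are compared with \<open>f z\<close> and
  the triangle inequality is integrated over \<open>z\<close> in the ball, so the oscillation bound
  is used twice. The constant is fixed before the function, the points and the radius;
  \<open>y\<close> may lie on the sphere.\<close>

lemma Morrey_inequality_ball:
  assumes s: "real DIM('a::euclidean_space) < s"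
  obtains M where "0 < M"
    and "\<And>(f :: 'a \<Rightarrow> real) x y d.
      (\<And>z. f differentiable (at z)) \<Longrightarrow> continuous_on UNIV (grad f) \<Longrightarrow> 0 < d \<Longrightarrow> y \<in> cball x d \<Longrightarrow>
      ennreal (\<bar>f x - f y\<bar> powr s)
      \<le> ennreal (M * d powr (s - real DIM('a))) * (\<integral>\<^sup>+z\<in>ball x d. ennreal (norm (grad f z) powr s) \<partial>lborel)"
proof -
  let ?n = "real DIM('a)"
  define \<omega> where "\<omega> = measure lborel (ball (0::'a) 1)"
  have \<omega>: "0 < \<omega>" unfolding \<omega>_def by (rule content_ball_pos) simp
  have "1 \<le> ?n" by (simp add: Suc_leI)
  then have s1: "1 < s" using s by linarith
  \<comment> \<open>One factor 2 comes from the diameter of the ball, the other from the two points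
    being compared.\<close>
  define \<kappa> where "\<kappa> = 4 / (1 - ?n / s)"
  have \<kappa>: "0 < \<kappa>" using s s1 by (simp add: \<kappa>_def)
  \<comment> \<open>Raising the bound to the power \<open>s\<close> leaves a division by the volume
    \<open>d ^ DIM('a) * \<omega>\<close>. The unit volume goes into \<open>M\<close>, the power of
    \<open>d\<close> lowers the exponent from \<open>s\<close> to \<open>s\<close> minus the
    dimension.\<close>
  define M where "M = \<kappa> powr s / \<omega>"
  have M: "0 < M" using \<kappa> \<omega> by (simp add: M_def)
  moreover have "ennreal (\<bar>f x - f y\<bar> powr s) \<le> ennreal (M * d powr (s - ?n)) *
      (\<integral>\<^sup>+z\<in>ball x d. ennreal (norm (grad f z) powr s) \<partial>lborel)"
    if diff: "\<And>z. f differentiable (at z)" and cont: "continuous_on UNIV (grad f)"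
      and d: "0 < d" and y: "y \<in> cball x d"
    for f :: "'a \<Rightarrow> real" and x y d
  proof (cases "(\<integral>\<^sup>+z\<in>ball x d. ennreal (norm (grad f z) powr s) \<partial>lborel) = \<infinity>")
    case True
    then show ?thesis using M d by (simp add: ennreal_mult_top)
  next
    case False
    then obtain A where A: "0 \<le> A"
        "(\<integral>\<^sup>+z\<in>ball x d. ennreal (norm (grad f z) powr s) \<partial>lborel) = ennreal A"
      by (metis ennreal_cases infinity_ennreal_def)
    define \<mu> where "\<mu> = measure lborel (ball x d)"
    have \<mu>: "emeasure lborel (ball x d) = ennreal \<mu>" "0 < \<mu>" "\<mu> = d ^ DIM('a) * \<omega>"
      unfolding \<mu>_def \<omega>_def using emeasure_lborel_ball_finite[of x d] d
      by (simp_all add: emeasure_eq_ennreal_measure content_ball_pos content_ball_conv_unit_ball[of d x, symmetric])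
    define B where "B = 2 * d / (1 - ?n / s) * A powr (1 / s) * \<mu> powr (1 - 1 / s)"
    have [measurable]: "ball x d \<in> sets borel" by simp
    have [measurable]: "f \<in> borel_measurable borel"
      using diff differentiable_imp_continuous_on[of f UNIV]
      by (intro borel_measurable_continuous_onI) (auto simp: differentiable_on_def)
    have "ennreal (\<bar>f x - f y\<bar> * \<mu>) = (\<integral>\<^sup>+z\<in>ball x d. ennreal \<bar>f x - f y\<bar> \<partial>lborel)"
      using \<mu> by (simp add: ennreal_mult nn_integral_cmult)
    also have "\<dots> \<le> (\<integral>\<^sup>+z. ennreal \<bar>f x - f z\<bar> * indicator (ball x d) z
        + ennreal \<bar>f y - f z\<bar> * indicator (ball x d) z \<partial>lborel)"
      by (intro nn_integral_mono) (auto simp: indicator_def simp flip: ennreal_plus intro!: ennreal_leI)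
    also have "\<dots> = (\<integral>\<^sup>+z\<in>ball x d. ennreal \<bar>f x - f z\<bar> \<partial>lborel)
        + (\<integral>\<^sup>+z\<in>ball x d. ennreal \<bar>f y - f z\<bar> \<partial>lborel)"
      by (intro nn_integral_add) measurable
    also have "\<dots> \<le> ennreal B + ennreal B"
      unfolding B_def \<mu>_def using A d y
      by (intro add_mono nn_integral_ball_oscillation[OF diff cont s]) auto
    also have "\<dots> = ennreal (2 * B)"
      using s s1 d by (simp add: B_def flip: ennreal_plus)
    finally have "\<bar>f x - f y\<bar> * \<mu> \<le> 2 * B"
      using s s1 d by (simp add: B_def)
    \<comment> \<open>One full factor \<open>\<mu>\<close> is split off so that it cancels against
      the volume on the left.\<close>
    also have "2 * B = \<kappa> * d * A powr (1 / s) * \<mu> powr (- (1 / s)) * \<mu>"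
      using \<mu> powr_add[of \<mu> 1 "- (1 / s)"] by (simp add: B_def \<kappa>_def)
    finally have "\<bar>f x - f y\<bar> \<le> \<kappa> * d * A powr (1 / s) * \<mu> powr (- (1 / s))"
      by (rule mult_right_le_imp_le) (rule \<mu>(2))
    then have "\<bar>f x - f y\<bar> powr s \<le> (\<kappa> * d * A powr (1 / s) * \<mu> powr (- (1 / s))) powr s"
      using s1 by (intro powr_mono2) auto
    also have "\<dots> = \<kappa> powr s * d powr s * A / \<mu>"
      using \<kappa> d A(1) \<mu>(2) s1 by (simp add: powr_mult powr_powr powr_neg_one)
    also have "\<dots> = M * d powr (s - ?n) * A"
      using d \<omega> by (simp add: \<mu> M_def powr_diff powr_realpow field_simps)
    finally show ?thesis
      using A M by (simp add: ennreal_mult[symmetric] ennreal_leI)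
  qed
  ultimately show thesis using that by blast
qed

section \<open>Test functions and nearest boundary points\<close>

lemma test_function_differentiable:
  "\<phi> \<in> test_functions \<Omega> \<Longrightarrow> \<phi> differentiable (at x)"
  unfolding test_functions_def using C_k.simps(2)[of 0 \<phi>] by blast

lemma test_function_continuous_grad:
  assumes "\<phi> \<in> test_functions \<Omega>"
  shows "continuous_on UNIV (grad \<phi>)"
proof -
  have "C_k (Suc 0) \<phi>" using assms unfolding test_functions_def by blast
  then have "continuous_on UNIV (\<lambda>x. frechet_derivative \<phi> (at x) b)" if "b \<in> Basis" for b
    using that by simp
  then show ?thesis unfolding grad_def by (intro continuous_intros) auto
qed

lemma test_function_outside: "\<phi> \<in> test_functions \<Omega> \<Longrightarrow> y \<notin> \<Omega> \<Longrightarrow> \<phi> y = 0"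
  unfolding test_functions_def using closure_subset[of "{x. \<phi> x \<noteq> 0}"] by blast

text \<open>Finiteness of the distance makes the frontier nonempty, and closedness gives a nearest
  point, which an open set does not contain. The open ball up to that point is connected, meets the
  set and misses its frontier, so it stays inside.\<close>

lemma bdry_dist_attained:
  fixes \<Omega> :: "'a::euclidean_space set"
  assumes "open \<Omega>" "x \<in> \<Omega>" "bdry_dist \<Omega> x \<noteq> \<infinity>"
  obtains y where "y \<notin> \<Omega>" "0 < dist x y" "bdry_dist \<Omega> x = ennreal (dist x y)" "ball x (dist x y) \<subseteq> \<Omega>"
proof -
  have "frontier \<Omega> \<noteq> {}" using assms(3) by (auto simp: bdry_dist_def)
  then obtain y where y: "y \<in> frontier \<Omega>" "\<And>z. z \<in> frontier \<Omega> \<Longrightarrow> dist x y \<le> dist x z"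
    using distance_attains_inf[OF frontier_closed, of \<Omega> x] by metis
  have "y \<notin> \<Omega>" using y(1) assms(1) by (simp add: frontier_def interior_open)
  moreover from this assms(2) have "0 < dist x y" by auto
  moreover have "bdry_dist \<Omega> x = ennreal (dist x y)"
    unfolding bdry_dist_def using y
    by (intro antisym INF_lower INF_greatest) (auto intro: ennreal_leI)
  moreover have "ball x (dist x y) \<subseteq> \<Omega>"
  proof (rule ccontr)
    assume "\<not> ball x (dist x y) \<subseteq> \<Omega>"
    moreover have "ball x (dist x y) \<inter> \<Omega> \<noteq> {}" using \<open>0 < dist x y\<close> assms(2) by force
    ultimately have "ball x (dist x y) \<inter> frontier \<Omega> \<noteq> {}"
      by (intro connected_Int_frontier) auto
    then show False using y(2) by force
  qed
  ultimately show thesis by (rule that)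
qed

section \<open>Passage from test functions to Sobolev functions\<close>

text \<open>Finitely many of the integrals may be infinite. Skipping the first \<open>k\<close>
  terms leaves integrable functions converging to 0 in L1, which have a subsequence converging
  almost everywhere; the shift is undone in the final index.\<close>

lemma nn_integral_tendsto_0_AE_subseq:
  fixes h :: "nat \<Rightarrow> 'a \<Rightarrow> real"
  assumes [measurable]: "\<And>n. h n \<in> borel_measurable M" and nonneg: "\<And>n x. 0 \<le> h n x"
    and lim: "(\<lambda>n. \<integral>\<^sup>+x. ennreal (h n x) \<partial>M) \<longlonglongrightarrow> 0"
  obtains r :: "nat \<Rightarrow> nat" where "strict_mono r" "AE x in M. (\<lambda>n. h (r n) x) \<longlonglongrightarrow> 0"
proof -
  have "eventually (\<lambda>n. (\<integral>\<^sup>+x. ennreal (h n x) \<partial>M) < 1) sequentially"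
    using order_tendstoD(2)[OF lim, of 1] by simp
  then obtain k where k: "\<And>n. k \<le> n \<Longrightarrow> (\<integral>\<^sup>+x. ennreal (h n x) \<partial>M) < 1"
    by (auto simp: eventually_sequentially)
  have "(\<integral>\<^sup>+x. ennreal (h (n + k) x) \<partial>M) < \<infinity>" for n
    by (rule less_trans[OF k]) auto
  then have int: "integrable M (h (n + k))" for n
    using nonneg by (intro integrableI_nonneg) auto
  have "(\<lambda>n. enn2real (\<integral>\<^sup>+x. ennreal (h (n + k) x) \<partial>M)) \<longlonglongrightarrow> enn2real 0"
    using LIMSEQ_ignore_initial_segment[OF lim, of k] by (intro tendsto_enn2real) auto
  moreover have "enn2real (\<integral>\<^sup>+x. ennreal (h (n + k) x) \<partial>M) = (\<integral>x. norm (h (n + k) x) \<partial>M)" for n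
    using nonneg by (subst integral_eq_nn_integral) auto
  ultimately have "(\<lambda>n. \<integral>x. norm (h (n + k) x) \<partial>M) \<longlonglongrightarrow> 0" by simp
  from tendsto_L1_AE_subseq[OF int this] obtain r :: "nat \<Rightarrow> nat"
    where "strict_mono r" "AE x in M. (\<lambda>n. h (r n + k) x) \<longlonglongrightarrow> 0" by auto
  then show thesis
    by (intro that[of "\<lambda>n. r n + k"]) (auto simp: strict_mono_def)
qed

lemma set_nn_integral_eq_lebesgue_on:
  "S \<in> sets lebesgue \<Longrightarrow> (\<integral>\<^sup>+x\<in>S. f x \<partial>lebesgue) = (\<integral>\<^sup>+x. f x \<partial>lebesgue_on S)"
  by (subst nn_integral_restrict_space) auto

lemma borel_measurable_lebesgue_on_subset:
  fixes f :: "'a::euclidean_space \<Rightarrow> 'b::euclidean_space"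
  assumes "f \<in> borel_measurable (lebesgue_on S)" "T \<subseteq> S"
  shows "f \<in> borel_measurable (lebesgue_on T)"
  using measurable_restrict_mono[OF assms] .

text \<open>Morrey's inequality is applied to approximating test functions, which vanish at a
  nearest boundary point, and then passes to the limit. The exceptional null set comes only from
  pointwise convergence of the test functions, hence serves all distances at once. \<open>M\<close>
  is chosen before the domain and \<open>u\<close>.\<close>

lemma W1p0_bdry_dist_bound:
  assumes s: "real DIM('a::euclidean_space) < s" and t: "1 < t"
  obtains M where "0 < M"
    and "\<And>(\<Omega> :: 'a set) u. open \<Omega> \<Longrightarrow> u \<in> W1p0 (s * t) \<Omega> \<Longrightarrow>
      AE x in lebesgue_on \<Omega>. \<forall>d\<ge>0. bdry_dist \<Omega> x = ennreal d \<longrightarrow>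
        ball x d \<subseteq> \<Omega> \<and>
        ennreal (\<bar>u x\<bar> powr s) \<le> ennreal (M * d powr (s - real DIM('a))) *
          (\<integral>\<^sup>+z\<in>ball x d. ennreal (norm (wgrad \<Omega> u z) powr s) \<partial>lebesgue)"
proof -
  let ?n = "real DIM('a)"
  obtain M where M: "0 < M"
    and morrey: "\<And>(f :: 'a \<Rightarrow> real) x y d.
      (\<And>z. f differentiable (at z)) \<Longrightarrow> continuous_on UNIV (grad f) \<Longrightarrow> 0 < d \<Longrightarrow> y \<in> cball x d \<Longrightarrow>
      ennreal (\<bar>f x - f y\<bar> powr s)
      \<le> ennreal (M * d powr (s - ?n)) * (\<integral>\<^sup>+z\<in>ball x d. ennreal (norm (grad f z) powr s) \<partial>lborel)"
    using Morrey_inequality_ball[OF s] by blast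
  have "1 \<le> ?n" by (simp add: Suc_leI)
  then have s1: "1 < s" using s by linarith
  have p0: "0 < s * t" using s1 t by simp
  define q where "q = t / (t - 1)"
  have q: "1 < q" "1 / t + 1 / q = 1" using t by (auto simp: q_def field_simps)
  \<comment> \<open>The extra factor \<open>2 powr s\<close> is the price of splitting the gradient
    of a test function into that of \<open>u\<close> and an error.\<close>
  have "AE x in lebesgue_on \<Omega>. \<forall>d\<ge>0. bdry_dist \<Omega> x = ennreal d \<longrightarrow>
        ball x d \<subseteq> \<Omega> \<and>
        ennreal (\<bar>u x\<bar> powr s) \<le> ennreal ((M * 2 powr s) * d powr (s - ?n)) *
          (\<integral>\<^sup>+z\<in>ball x d. ennreal (norm (wgrad \<Omega> u z) powr s) \<partial>lebesgue)"
    if \<Omega>: "open \<Omega>" and u: "u \<in> W1p0 (s * t) \<Omega>" for \<Omega> :: "'a set" and u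
  proof -
    define G where "G = wgrad \<Omega> u"
    have \<Omega>m: "\<Omega> \<in> sets lebesgue" using \<Omega> by simp
    have um [measurable]: "u \<in> borel_measurable (lebesgue_on \<Omega>)"
      and Gm: "G \<in> borel_measurable (lebesgue_on \<Omega>)"
      using u by (auto simp: W1p0_def W1p_def Lp_def G_def)
    from u obtain \<phi> where tf: "\<And>n. \<phi> n \<in> test_functions \<Omega>"
      and l1: "(\<lambda>n. \<integral>\<^sup>+x\<in>\<Omega>. ennreal (\<bar>\<phi> n x - u x\<bar> powr (s * t)) \<partial>lebesgue) \<longlonglongrightarrow> 0"
      and l2: "(\<lambda>n. \<integral>\<^sup>+x\<in>\<Omega>. ennreal (norm (grad (\<phi> n) x - G x) powr (s * t)) \<partial>lebesgue) \<longlonglongrightarrow> 0"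
      unfolding W1p0_def G_def by blast
    note diff = test_function_differentiable[OF tf] and cont = test_function_continuous_grad[OF tf]
    have \<phi>b: "\<phi> n \<in> borel_measurable borel" for n
      using diff differentiable_imp_continuous_on[of "\<phi> n" UNIV]
      by (intro borel_measurable_continuous_onI) (auto simp: differentiable_on_def)
    have gb: "grad (\<phi> n) \<in> borel_measurable borel" for n
      using cont by (rule borel_measurable_continuous_onI)
    have restr: "f \<in> borel_measurable (lebesgue_on S)" if "f \<in> borel_measurable borel"
      for f :: "'a \<Rightarrow> 'b::euclidean_space" and S
      using that by (intro measurable_restrict_space1 measurable_completion) simp
    have \<phi>m [measurable]: "\<phi> n \<in> borel_measurable (lebesgue_on \<Omega>)" for n
      by (rule restr[OF \<phi>b])
    obtain r :: "nat \<Rightarrow> nat" where r: "strict_mono r"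
      and ae: "AE x in lebesgue_on \<Omega>. (\<lambda>n. \<bar>\<phi> (r n) x - u x\<bar> powr (s * t)) \<longlonglongrightarrow> 0"
      using l1 unfolding set_nn_integral_eq_lebesgue_on[OF \<Omega>m]
      by (rule nn_integral_tendsto_0_AE_subseq[rotated 2]) auto
    define e where "e = (\<lambda>n. \<integral>\<^sup>+x\<in>\<Omega>. ennreal (norm (grad (\<phi> n) x - G x) powr (s * t)) \<partial>lebesgue)"
    have e0: "(\<lambda>n. enn2real (e (r n))) \<longlonglongrightarrow> 0"
      using LIMSEQ_subseq_LIMSEQ[OF l2 r] by (intro tendsto_enn2real) (simp_all add: e_def o_def)
    have "(\<lambda>n. e (r n)) \<longlonglongrightarrow> 0"
      using LIMSEQ_subseq_LIMSEQ[OF l2 r] by (simp add: e_def o_def)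
    then have "eventually (\<lambda>n. e (r n) < 1) sequentially"
      by (rule order_tendstoD) simp
    \<comment> \<open>Since \<open>enn2real\<close> sends infinity to 0, the real error controls the
      extended one only where the latter is finite, which holds for all large indices.\<close>
    then have efin: "eventually (\<lambda>n. e (r n) \<le> ennreal (enn2real (e (r n)))) sequentially"
    proof eventually_elim
      case (elim n)
      then have "e (r n) < \<infinity>" by (rule less_trans) simp
      then show ?case by simp
    qed
    have "AE x in lebesgue_on \<Omega>. x \<in> \<Omega>"
      by (rule AE_I2) simp
    with ae show ?thesis
    proof eventually_elim
      case (elim x)
      show ?case
      proof (intro allI impI)
        fix d :: real assume d: "0 \<le> d" "bdry_dist \<Omega> x = ennreal d"
        obtain y where y: "y \<notin> \<Omega>" "0 < dist x y" "bdry_dist \<Omega> x = ennreal (dist x y)"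
            "ball x (dist x y) \<subseteq> \<Omega>"
          using bdry_dist_attained[OF \<Omega>, of x] elim d by auto
        have d_eq: "d = dist x y" and d0: "0 < d" and sub: "ball x d \<subseteq> \<Omega>"
          using y d by auto
        let ?B = "ball x d"
        have Bm: "?B \<in> sets lebesgue" by simp
        have Gm' [measurable]: "G \<in> borel_measurable (lebesgue_on ?B)"
          using borel_measurable_lebesgue_on_subset[OF Gm sub] .
        have gm' [measurable]: "grad (\<phi> n) \<in> borel_measurable (lebesgue_on ?B)" for n
          by (rule restr[OF gb])
        define \<mu> where "\<mu> = measure lborel ?B"
        have \<mu>: "emeasure lebesgue ?B = ennreal \<mu>" "0 \<le> \<mu>"
          unfolding \<mu>_def using emeasure_lborel_ball_finite[of x d]
          by (auto simp: emeasure_eq_ennreal_measure)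
        define Q where "Q = (\<integral>\<^sup>+z\<in>?B. ennreal (norm (G z) powr s) \<partial>lebesgue)"
        \<comment> \<open>Hoelder's inequality with exponents \<open>t\<close> and \<open>q\<close>
          against the constant 1 on the ball turns the gradient error of order \<open>s * t\<close>
          into this bound for the error of order \<open>s\<close>.\<close>
        define \<delta> where "\<delta> = (\<lambda>n. ennreal (enn2real (e (r n)) powr (1 / t) * \<mu> powr (1 / q)))"
        define c where "c = M * d powr (s - ?n)"
        have c0: "0 \<le> c" using M by (simp add: c_def)
        have bound: "ennreal (\<bar>\<phi> (r n) x\<bar> powr s) \<le> ennreal c * (ennreal (2 powr s) * (Q + \<delta> n))"
          if fin: "e (r n) \<le> ennreal (enn2real (e (r n)))" for n
        proof -
          let ?f = "\<phi> (r n)"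
          have split: "norm (grad ?f z) powr s \<le> 2 powr s * (norm (G z) powr s + norm (grad ?f z - G z) powr s)"
            for z
          proof -
            let ?a = "norm (G z)" and ?b = "norm (grad ?f z - G z)"
            have "norm (grad ?f z) \<le> ?a + ?b" by (metis add.commute norm_triangle_sub)
            also have "\<dots> \<le> 2 * max ?a ?b" by simp
            finally have "norm (grad ?f z) powr s \<le> (2 * max ?a ?b) powr s"
              using s1 by (intro powr_mono2) auto
            also have "\<dots> = 2 powr s * (max ?a ?b) powr s"
              by (rule powr_mult)
            also have "\<dots> \<le> 2 powr s * (?a powr s + ?b powr s)"
              by (intro mult_left_mono) (auto simp: max_def)
            finally show ?thesis .
          qed
          have "ennreal (\<bar>?f x\<bar> powr s)
            \<le> ennreal c * (\<integral>\<^sup>+z\<in>?B. ennreal (norm (grad ?f z) powr s) \<partial>lborel)"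
            using morrey[OF diff[of "r n"] cont[of "r n"] d0, of y x] test_function_outside[OF tf y(1)]
            by (simp add: d_eq c_def)
          also have "(\<integral>\<^sup>+z\<in>?B. ennreal (norm (grad ?f z) powr s) \<partial>lborel)
              = (\<integral>\<^sup>+z. ennreal (norm (grad ?f z) powr s) \<partial>lebesgue_on ?B)"
            by (simp add: set_nn_integral_eq_lebesgue_on[symmetric] nn_integral_completion)
          also have "\<dots> \<le> (\<integral>\<^sup>+z. ennreal (2 powr s) *
              (ennreal (norm (G z) powr s) + ennreal (norm (grad ?f z - G z) powr s)) \<partial>lebesgue_on ?B)"
            using split by (intro nn_integral_mono) (simp flip: ennreal_mult ennreal_plus add: ennreal_leI)
          also have "\<dots> = ennreal (2 powr s) * (Q +
              (\<integral>\<^sup>+z. ennreal (norm (grad ?f z - G z) powr s) \<partial>lebesgue_on ?B))"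
            by (simp add: nn_integral_cmult nn_integral_add Q_def set_nn_integral_eq_lebesgue_on)
          also have "(\<integral>\<^sup>+z. ennreal (norm (grad ?f z - G z) powr s) \<partial>lebesgue_on ?B) \<le> \<delta> n"
          proof -
            have "(\<integral>\<^sup>+z. ennreal (norm (grad ?f z - G z) powr s * 1) \<partial>lebesgue_on ?B) \<le> \<delta> n"
              unfolding \<delta>_def
            proof (rule nn_integral_Holder[OF t q])
              have "(\<integral>\<^sup>+z. ennreal ((norm (grad ?f z - G z) powr s) powr t) \<partial>lebesgue_on ?B) \<le> e (r n)"
                unfolding set_nn_integral_eq_lebesgue_on[OF Bm, symmetric] e_def powr_powr
                using sub by (intro nn_integral_mono) (auto simp: indicator_def)
              then show "(\<integral>\<^sup>+z. ennreal ((norm (grad ?f z - G z) powr s) powr t) \<partial>lebesgue_on ?B)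
                  \<le> ennreal (enn2real (e (r n)))"
                using fin by (rule order_trans)
            qed (use \<mu> in \<open>auto simp: emeasure_restrict_space\<close>)
            then show ?thesis by simp
          qed
          finally show ?thesis by (simp add: add_left_mono mult_left_mono)
        qed
        \<comment> \<open>Taking the root of order \<open>s * t\<close> turns convergence of the
          powers into convergence of the values.\<close>
        have "(\<lambda>n. (\<bar>\<phi> (r n) x - u x\<bar> powr (s * t)) powr (1 / (s * t))) \<longlonglongrightarrow> 0 powr (1 / (s * t))"
          using elim p0 by (intro tendsto_powr') auto
        then have "(\<lambda>n. \<bar>\<phi> (r n) x - u x\<bar>) \<longlonglongrightarrow> 0"
          using s1 t by (simp add: powr_powr)
        then have "(\<lambda>n. \<phi> (r n) x) \<longlonglongrightarrow> u x"
          by (simp add: tendsto_rabs_zero_iff LIM_zero_iff)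
        then have "(\<lambda>n. ennreal (\<bar>\<phi> (r n) x\<bar> powr s)) \<longlonglongrightarrow> ennreal (\<bar>u x\<bar> powr s)"
          using s1 by (intro tendsto_ennrealI tendsto_powr' tendsto_rabs) auto
        moreover have "(\<lambda>n. ennreal c * (ennreal (2 powr s) * (Q + \<delta> n)))
            \<longlonglongrightarrow> ennreal c * (ennreal (2 powr s) * (Q + ennreal (0 powr (1 / t) * \<mu> powr (1 / q))))"
          unfolding \<delta>_def using t e0
          by (intro ennreal_tendsto_cmult tendsto_add tendsto_const tendsto_ennrealI tendsto_mult tendsto_powr') auto
        moreover have "eventually (\<lambda>n. ennreal (\<bar>\<phi> (r n) x\<bar> powr s)
            \<le> ennreal c * (ennreal (2 powr s) * (Q + \<delta> n))) sequentially"
          using efin by eventually_elim (rule bound)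
        ultimately have "ennreal (\<bar>u x\<bar> powr s)
            \<le> ennreal c * (ennreal (2 powr s) * (Q + ennreal (0 powr (1 / t) * \<mu> powr (1 / q))))"
          using tendsto_le[OF trivial_limit_sequentially] by blast
        also have "\<dots> = ennreal ((M * 2 powr s) * d powr (s - ?n)) * Q"
          using t M by (simp add: c_def ennreal_mult mult_ac)
        finally show "?B \<subseteq> \<Omega> \<and> ennreal (\<bar>u x\<bar> powr s)
            \<le> ennreal ((M * 2 powr s) * d powr (s - ?n)) *
              (\<integral>\<^sup>+z\<in>?B. ennreal (norm (wgrad \<Omega> u z) powr s) \<partial>lebesgue)"
          using sub by (simp add: Q_def G_def)
      qed
    qed
  qed
  then show thesis using M by (intro that[of "M * 2 powr s"]) auto
qed

section \<open>Extended powers and the weighted Hoelder inequality\<close>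

lemma epowr_ennreal_neg:
  "a < 0 \<Longrightarrow> epowr (ennreal x) a = (if x \<le> 0 then \<infinity> else ennreal (x powr a))"
  by (auto simp: epowr_def ennreal_eq_0_iff)

lemma epowr_ennreal_pos: "0 < a \<Longrightarrow> 0 \<le> x \<Longrightarrow> epowr (ennreal x) a = ennreal (x powr a)"
  by (auto simp: epowr_def ennreal_eq_0_iff)

lemma epowr_top: "0 < a \<Longrightarrow> epowr \<infinity> a = \<infinity>"
  by (simp add: epowr_def)

lemma epowr_pos: "0 < a \<Longrightarrow> 0 < x \<Longrightarrow> 0 < epowr x a"
  by (cases x) (auto simp: epowr_def ennreal_eq_0_iff)

lemma epowr_ennreal_measurable:
  assumes [measurable]: "v \<in> borel_measurable M" and "a < 0"
  shows "(\<lambda>x. epowr (ennreal (v x)) a) \<in> borel_measurable M"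
  unfolding epowr_ennreal_neg[OF assms(2)] by measurable

text \<open>Where \<open>v\<close> is not positive, \<open>ennreal\<close> maps it to 0 and the
  negative power is infinite; a finite integral allows this only on a null set.\<close>

lemma AE_pos_of_dual_finite:
  assumes [measurable]: "v \<in> borel_measurable M" and a: "a < 0"
    and fin: "(\<integral>\<^sup>+x. epowr (ennreal (v x)) a \<partial>M) \<noteq> \<infinity>"
  shows "AE x in M. 0 < v x"
proof -
  have "AE x in M. epowr (ennreal (v x)) a \<noteq> \<infinity>"
    using epowr_ennreal_measurable[OF assms(1) a] fin by (intro nn_integral_PInf_AE) auto
  then show ?thesis by eventually_elim (auto simp: epowr_ennreal_neg[OF a] split: if_splits)
qed

text \<open>Write the integrand as \<open>v powr (1 / t) * G powr s\<close> times
  \<open>v powr (- (1 / t))\<close> and use the exponents \<open>t\<close> and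
  \<open>t / (t - 1)\<close>; the second factor then becomes the dual weight. The splitting needs
  \<open>v\<close> positive almost everywhere, which the finite dual integral provides.\<close>

lemma weighted_Holder:
  fixes v G :: "'a \<Rightarrow> real"
  assumes t: "1 < t"
    and [measurable]: "v \<in> borel_measurable M" "G \<in> borel_measurable M"
    and I: "(\<integral>\<^sup>+x. ennreal (v x * G x powr (s * t)) \<partial>M) \<le> ennreal I" "0 \<le> I"
    and g: "(\<integral>\<^sup>+x. epowr (ennreal (v x)) (- 1 / (t - 1)) \<partial>M) \<le> ennreal g" "0 \<le> g"
  shows "(\<integral>\<^sup>+x. ennreal (G x powr s) \<partial>M) \<le> ennreal (I powr (1 / t) * g powr (1 - 1 / t))"
proof -
  define q where "q = t / (t - 1)"
  have q: "1 < q" "1 / t + 1 / q = 1" "1 / q = 1 - 1 / t" using t by (auto simp: q_def field_simps)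
  have neg: "- 1 / (t - 1) < 0" using t by simp
  have "(\<integral>\<^sup>+x. epowr (ennreal (v x)) (- 1 / (t - 1)) \<partial>M) \<noteq> \<infinity>"
    using g by (auto simp: top_unique)
  with neg have pos: "AE x in M. 0 < v x" by (intro AE_pos_of_dual_finite) auto
  have "(\<integral>\<^sup>+x. ennreal (G x powr s) \<partial>M)
      = (\<integral>\<^sup>+x. ennreal ((v x powr (1 / t) * G x powr s) * v x powr (- (1 / t))) \<partial>M)"
  proof (rule nn_integral_cong_AE)
    show "AE x in M. ennreal (G x powr s)
        = ennreal ((v x powr (1 / t) * G x powr s) * v x powr (- (1 / t)))"
      using pos by eventually_elim (simp add: powr_minus field_simps)
  qed
  also have "\<dots> \<le> ennreal (I powr (1 / t) * g powr (1 / q))"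
  proof (rule nn_integral_Holder[OF t q(1,2)])
    have "(\<integral>\<^sup>+x. ennreal ((v x powr (1 / t) * G x powr s) powr t) \<partial>M)
        = (\<integral>\<^sup>+x. ennreal (v x * G x powr (s * t)) \<partial>M)"
    proof (rule nn_integral_cong_AE)
      show "AE x in M. ennreal ((v x powr (1 / t) * G x powr s) powr t) = ennreal (v x * G x powr (s * t))"
        using pos by eventually_elim (use t in \<open>simp add: powr_mult powr_powr\<close>)
    qed
    then show "(\<integral>\<^sup>+x. ennreal ((v x powr (1 / t) * G x powr s) powr t) \<partial>M) \<le> ennreal I"
      using I by simp
    have e: "- (1 / t) * q = - 1 / (t - 1)" using t by (simp add: q_def field_simps)
    have "(\<integral>\<^sup>+x. ennreal ((v x powr (- (1 / t))) powr q) \<partial>M)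
        = (\<integral>\<^sup>+x. epowr (ennreal (v x)) (- 1 / (t - 1)) \<partial>M)"
    proof (rule nn_integral_cong_AE)
      show "AE x in M. ennreal ((v x powr (- (1 / t))) powr q) = epowr (ennreal (v x)) (- 1 / (t - 1))"
        using pos by eventually_elim (use t in \<open>simp only: powr_powr e, simp add: epowr_ennreal_neg\<close>)
    qed
    then show "(\<integral>\<^sup>+x. ennreal ((v x powr (- (1 / t))) powr q) \<partial>M) \<le> ennreal g"
      using g by simp
  qed (use I g in auto)
  finally show ?thesis by (simp add: q(3))
qed

section \<open>Muckenhoupt weights and positivity of the factors\<close>

text \<open>The truncations to closed balls of radius \<open>n\<close> are measurable and at each
  point eventually equal to \<open>v\<close>.\<close>

lemma absolutely_integrable_compact_measurable:
  fixes v :: "'a::euclidean_space \<Rightarrow> real"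
  assumes "\<And>K. compact K \<Longrightarrow> v absolutely_integrable_on K"
  shows "v \<in> borel_measurable lebesgue"
proof (rule borel_measurable_LIMSEQ_real)
  show "(\<lambda>x. indicator (cball 0 (real n)) x *\<^sub>R v x) \<in> borel_measurable lebesgue" for n
    using assms[OF compact_cball, of 0 "real n"] unfolding set_integrable_def
    by (rule borel_measurable_integrable)
  show "(\<lambda>n. indicator (cball 0 (real n)) x *\<^sub>R v x) \<longlonglongrightarrow> v x" for x
  proof (rule tendsto_eventually)
    obtain k where "norm x \<le> real k" using real_arch_simple by blast
    then have "indicator (cball 0 (real n)) x *\<^sub>R v x = v x" if "k \<le> n" for n
      using that by (auto simp: indicator_def)
    then show "eventually (\<lambda>n. indicator (cball 0 (real n)) x *\<^sub>R v x = v x) sequentially"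
      by (auto simp: eventually_sequentially)
  qed
qed

lemma muckenhouptD:
  assumes "v \<in> muckenhoupt t"
  shows "AE x in lebesgue. 0 \<le> v x" "v \<in> borel_measurable lebesgue"
    "0 < r \<Longrightarrow> (\<integral>\<^sup>+z\<in>ball x r. epowr (ennreal (v z)) (- 1 / (t - 1)) \<partial>lebesgue) < \<infinity>"
  using assms absolutely_integrable_compact_measurable[of v] by (auto simp: muckenhoupt_def)

lemma emeasure_lebesgue_open_pos:
  fixes S :: "'a::euclidean_space set"
  assumes "open S" "S \<noteq> {}"
  shows "0 < emeasure lebesgue S"
proof -
  obtain x r where "0 < r" "ball x r \<subseteq> S" using assms openE by blast
  then have "emeasure lebesgue (ball x r) \<le> emeasure lebesgue S"
    using assms by (intro emeasure_mono) auto
  moreover have "0 < emeasure lebesgue (ball x r)"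
    using content_ball_pos[OF \<open>0 < r\<close>, of x] emeasure_lborel_ball_finite[of x r]
    by (auto simp: emeasure_eq_ennreal_measure)
  ultimately show ?thesis by (rule less_le_trans[rotated])
qed

lemma nn_integral_open_pos:
  fixes f :: "'a::euclidean_space \<Rightarrow> ennreal"
  assumes [measurable]: "f \<in> borel_measurable lebesgue" and S: "open S" "S \<noteq> {}"
    and pos: "AE x in lebesgue. x \<in> S \<longrightarrow> 0 < f x"
  shows "0 < (\<integral>\<^sup>+x\<in>S. f x \<partial>lebesgue)"
proof (rule ccontr)
  have [measurable]: "S \<in> sets lebesgue" using S by simp
  assume "\<not> ?thesis"
  then have "AE x in lebesgue. f x * indicator S x = 0"
    by (subst (asm) not_gr_zero, subst (asm) nn_integral_0_iff_AE) auto
  with pos have "AE x in lebesgue. x \<notin> S"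
    by eventually_elim (auto simp: indicator_def split: if_splits)
  then have "emeasure lebesgue S = 0"
    by (subst (asm) AE_iff_measurable[of S]) auto
  then show False using emeasure_lebesgue_open_pos[OF S] by simp
qed

text \<open>On a ball inside \<open>S\<close> the dual integral is finite, so \<open>w\<close> is
  positive almost everywhere there.\<close>

lemma muckenhoupt_nn_integral_open_pos:
  fixes w :: "'a::euclidean_space \<Rightarrow> real"
  assumes w: "w \<in> muckenhoupt t" and t: "1 < t" and S: "open S" "S \<noteq> {}"
  shows "0 < (\<integral>\<^sup>+x\<in>S. ennreal (w x) \<partial>lebesgue)"
proof -
  obtain x r where r: "0 < r" "ball x r \<subseteq> S" using S openE by blast
  note wm [measurable] = muckenhouptD(2)[OF w]
  have "w \<in> borel_measurable (lebesgue_on (ball x r))"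
    using wm by (rule measurable_restrict_space1)
  then have "AE z in lebesgue_on (ball x r). 0 < w z"
    using muckenhouptD(3)[OF w r(1), of x] t
    by (intro AE_pos_of_dual_finite[where a = "- 1 / (t - 1)"])
      (auto simp: set_nn_integral_eq_lebesgue_on[symmetric])
  then have "AE z in lebesgue. z \<in> ball x r \<longrightarrow> 0 < w z"
    by (subst (asm) AE_restrict_space_iff) auto
  then have "AE z in lebesgue. z \<in> ball x r \<longrightarrow> 0 < ennreal (w z)" by eventually_elim auto
  then have "0 < (\<integral>\<^sup>+z\<in>ball x r. ennreal (w z) \<partial>lebesgue)"
    using r(1) by (intro nn_integral_open_pos) auto
  also have "\<dots> \<le> (\<integral>\<^sup>+z\<in>S. ennreal (w z) \<partial>lebesgue)"
    using r(2) by (intro nn_integral_mono) (auto simp: indicator_def)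
  finally show ?thesis .
qed

lemma eball_eq: "eball x (ennreal r) = ball x r" "eball x \<infinity> = UNIV"
  by (auto simp: eball_def ennreal_less_iff)

text \<open>Positivity of each factor of the final product is what rules out 0 times infinity, which
  is 0 in \<open>ennreal\<close>.\<close>

lemma inner_radius_pos:
  fixes \<Omega> :: "'a::euclidean_space set"
  assumes "open \<Omega>" "\<Omega> \<noteq> {}"
  shows "0 < inner_radius \<Omega>"
proof -
  obtain x where x: "x \<in> \<Omega>" using assms by blast
  have "0 < bdry_dist \<Omega> x"
  proof (cases "bdry_dist \<Omega> x = \<infinity>")
    case False
    with assms(1) x obtain y where "0 < dist x y" "bdry_dist \<Omega> x = ennreal (dist x y)"
      by (elim bdry_dist_attained)
    then show ?thesis by simp
  qed simp
  also have "\<dots> \<le> inner_radius \<Omega>" unfolding inner_radius_def using x by (rule SUP_upper)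
  finally show ?thesis .
qed

text \<open>The value \<open>ennreal (v z)\<close> is never infinite, so its negative power is
  positive at every point.\<close>

lemma dual_weight_sup_pos:
  fixes \<Omega> :: "'a::euclidean_space set"
  assumes v: "v \<in> muckenhoupt t" and t: "1 < t" and "\<Omega> \<noteq> {}" and r: "0 < r"
  shows "0 < dual_weight_sup t \<Omega> v r"
proof -
  obtain x where x: "x \<in> \<Omega>" using assms by blast
  have neg: "- 1 / (t - 1) < 0" using t by simp
  have "open (eball x r)" by (cases r) (auto simp: eball_eq simp flip: infinity_ennreal_def)
  moreover have "eball x r \<noteq> {}" using r by (auto simp: eball_def intro: exI[of _ x])
  ultimately have "0 < (\<integral>\<^sup>+z\<in>eball x r. epowr (ennreal (v z)) (- 1 / (t - 1)) \<partial>lebesgue)"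
    using epowr_ennreal_measurable[OF muckenhouptD(2)[OF v] neg]
    using t by (intro nn_integral_open_pos) (auto simp: epowr_ennreal_neg)
  also have "\<dots> \<le> dual_weight_sup t \<Omega> v r" unfolding dual_weight_sup_def using x by (rule SUP_upper)
  finally show ?thesis .
qed

section \<open>The inequality when all quantities are finite\<close>

text \<open>The pointwise bound enters as a hypothesis on \<open>M\<close>, so that one constant can
  serve all domains, weights and solutions. Radius, dual supremum and total weight are represented
  by real numbers, which makes the final cancellation legitimate.\<close>

lemma weak_solution_inequality:
  fixes \<Omega> :: "'a::euclidean_space set"
  assumes s: "real DIM('a) < s" and t: "1 < t"
    and M: "0 < M" "AE x in lebesgue_on \<Omega>. \<forall>d\<ge>0. bdry_dist \<Omega> x = ennreal d \<longrightarrow>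
        ball x d \<subseteq> \<Omega> \<and>
        ennreal (\<bar>u x\<bar> powr s) \<le> ennreal (M * d powr (s - real DIM('a))) *
          (\<integral>\<^sup>+z\<in>ball x d. ennreal (norm (wgrad \<Omega> u z) powr s) \<partial>lebesgue)"
    and \<Omega>: "open \<Omega>" and v: "v \<in> muckenhoupt t" and w: "w \<in> muckenhoupt t"
    and u: "u \<in> W1p0 (s * t) \<Omega>" and nontriv: "\<not> (AE x in lebesgue_on \<Omega>. u x = 0)"
    and sol: "weak_solution (s * t) \<Omega> v w u"
    and r: "inner_radius \<Omega> = ennreal r" "0 \<le> r"
    and g: "dual_weight_sup t \<Omega> v (inner_radius \<Omega>) = ennreal g" "0 \<le> g"
    and W: "(\<integral>\<^sup>+z\<in>\<Omega>. ennreal (w z) \<partial>lebesgue) = ennreal W" "0 \<le> W"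
  shows "1 \<le> M powr t * r powr (s * t - t * real DIM('a)) * g powr (t - 1) * W"
proof -
  let ?n = "real DIM('a)"
  define p where "p = s * t"
  define G where "G = wgrad \<Omega> u"
  have "1 \<le> ?n" by (simp add: Suc_leI)
  then have s1: "1 < s" using s by linarith
  have p0: "0 < p" using s1 t by (simp add: p_def)
  have \<Omega>m [measurable]: "\<Omega> \<in> sets lebesgue" using \<Omega> by simp
  have Gm: "G \<in> borel_measurable (lebesgue_on \<Omega>)"
    using u by (auto simp: W1p0_def W1p_def Lp_def G_def)
  note vm = muckenhouptD(2)[OF v] and wm = muckenhouptD(2)[OF w]
  have AE_on: "AE x in lebesgue_on \<Omega>. P x" if "AE x in lebesgue. P x" for P
    using that by (subst AE_restrict_space_iff) (auto elim: eventually_mono)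
  note v0 = AE_on[OF muckenhouptD(1)[OF v]] and w0 = AE_on[OF muckenhouptD(1)[OF w]]
  \<comment> \<open>With \<open>u\<close> as test function the integrands become pure powers. Where
    the gradient or \<open>u\<close> vanishes, both sides are 0 by the convention for
    \<open>powr\<close> at 0.\<close>
  have eqv: "v x * norm (G x) powr (p - 2) * (G x \<bullet> G x) = v x * norm (G x) powr p" for x
    by (cases "G x = 0") (auto simp: powr_diff power2_norm_eq_inner[symmetric])
  have equ: "w x * \<bar>u x\<bar> powr (p - 2) * u x * u x = w x * \<bar>u x\<bar> powr p" for x
    by (cases "u x = 0") (auto simp: powr_diff power2_eq_square)
  have test: "set_integrable lebesgue \<Omega> (\<lambda>x. v x * norm (G x) powr (p - 2) * (G x \<bullet> G x))"
      "set_integrable lebesgue \<Omega> (\<lambda>x. w x * \<bar>u x\<bar> powr (p - 2) * u x * u x)"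
      "(LINT x:\<Omega>|lebesgue. v x * norm (G x) powr (p - 2) * (G x \<bullet> G x))
        = (LINT x:\<Omega>|lebesgue. w x * \<bar>u x\<bar> powr (p - 2) * u x * u x)"
    using sol u unfolding weak_solution_def p_def[symmetric] G_def by blast+
  have int: "integrable (lebesgue_on \<Omega>) (\<lambda>x. v x * norm (G x) powr p)"
      "integrable (lebesgue_on \<Omega>) (\<lambda>x. w x * \<bar>u x\<bar> powr p)"
    and eq: "(LINT x|lebesgue_on \<Omega>. v x * norm (G x) powr p) = (LINT x|lebesgue_on \<Omega>. w x * \<bar>u x\<bar> powr p)"
    using test unfolding eqv equ
    by (simp_all add: set_integrable_def set_lebesgue_integral_def
        integrable_restrict_space integral_restrict_space)
  define I where "I = (LINT x|lebesgue_on \<Omega>. v x * norm (G x) powr p)"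
  have "AE x in lebesgue_on \<Omega>. 0 \<le> v x * norm (G x) powr p"
    using v0 by eventually_elim simp
  then have Iv: "(\<integral>\<^sup>+x. ennreal (v x * norm (G x) powr p) \<partial>lebesgue_on \<Omega>) = ennreal I" and I0: "0 \<le> I"
    unfolding I_def using int(1) by (auto intro: nn_integral_eq_integral integral_nonneg_AE)
  have "AE x in lebesgue_on \<Omega>. 0 \<le> w x * \<bar>u x\<bar> powr p"
    using w0 by eventually_elim simp
  then have Iw: "(\<integral>\<^sup>+x. ennreal (w x * \<bar>u x\<bar> powr p) \<partial>lebesgue_on \<Omega>) = ennreal I"
    unfolding I_def eq using int(2) by (intro nn_integral_eq_integral)
  define \<kappa> where "\<kappa> = M powr t * r powr (p - t * ?n) * g powr (t - 1)"
  have \<kappa>0: "0 \<le> \<kappa>" by (simp add: \<kappa>_def)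
  have "AE x in lebesgue_on \<Omega>. x \<in> \<Omega>"
    by (rule AE_I2) simp
  with M(2) have bound: "AE x in lebesgue_on \<Omega>. \<bar>u x\<bar> powr p \<le> \<kappa> * I"
  proof eventually_elim
    case (elim x)
    have le: "bdry_dist \<Omega> x \<le> ennreal r"
      unfolding r(1)[symmetric] inner_radius_def using elim(2) by (rule SUP_upper)
    \<comment> \<open>A finite inner radius makes every boundary distance finite, so the pointwise
      bound applies at \<open>x\<close>.\<close>
    then obtain d where d: "0 \<le> d" "bdry_dist \<Omega> x = ennreal d" "d \<le> r"
      using r(2) by (cases "bdry_dist \<Omega> x") (auto simp: top_unique)
    let ?B = "ball x d"
    have sub: "?B \<subseteq> \<Omega>"
      and ux: "ennreal (\<bar>u x\<bar> powr s) \<le> ennreal (M * d powr (s - ?n)) *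
          (\<integral>\<^sup>+z\<in>?B. ennreal (norm (G z) powr s) \<partial>lebesgue)"
      using elim(1) d by (auto simp: G_def)
    have "(\<integral>\<^sup>+z. ennreal (norm (G z) powr s) \<partial>lebesgue_on ?B) \<le> ennreal (I powr (1 / t) * g powr (1 - 1 / t))"
    proof (rule weighted_Holder[OF t])
      show "v \<in> borel_measurable (lebesgue_on ?B)" using vm by (rule measurable_restrict_space1)
      show "(\<lambda>z. norm (G z)) \<in> borel_measurable (lebesgue_on ?B)"
        using borel_measurable_lebesgue_on_subset[OF Gm sub] by measurable
      have "(\<integral>\<^sup>+z\<in>?B. ennreal (v z * norm (G z) powr p) \<partial>lebesgue)
          \<le> (\<integral>\<^sup>+z\<in>\<Omega>. ennreal (v z * norm (G z) powr p) \<partial>lebesgue)"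
        using sub by (intro nn_integral_mono) (auto simp: indicator_def)
      then show "(\<integral>\<^sup>+z. ennreal (v z * norm (G z) powr (s * t)) \<partial>lebesgue_on ?B) \<le> ennreal I"
        by (simp add: set_nn_integral_eq_lebesgue_on Iv p_def[symmetric])
      \<comment> \<open>The ball reaching the boundary lies in the ball of radius \<open>r\<close>
        about the same centre, over which the dual integral is at most \<open>g\<close>.\<close>
      have "(\<integral>\<^sup>+z\<in>?B. epowr (ennreal (v z)) (- 1 / (t - 1)) \<partial>lebesgue)
          \<le> (\<integral>\<^sup>+z\<in>eball x (inner_radius \<Omega>). epowr (ennreal (v z)) (- 1 / (t - 1)) \<partial>lebesgue)"
        using d(3) by (intro nn_integral_mono) (auto simp: indicator_def r eball_eq)
      also have "\<dots> \<le> dual_weight_sup t \<Omega> v (inner_radius \<Omega>)"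
        unfolding dual_weight_sup_def using elim(2) by (rule SUP_upper)
      finally show "(\<integral>\<^sup>+z. epowr (ennreal (v z)) (- 1 / (t - 1)) \<partial>lebesgue_on ?B) \<le> ennreal g"
        by (simp add: set_nn_integral_eq_lebesgue_on g)
    qed (use I0 g in auto)
    then have "ennreal (\<bar>u x\<bar> powr s)
        \<le> ennreal (M * d powr (s - ?n)) * ennreal (I powr (1 / t) * g powr (1 - 1 / t))"
      using ux by (elim order_trans) (simp add: set_nn_integral_eq_lebesgue_on mult_left_mono)
    also have "\<dots> = ennreal (M * d powr (s - ?n) * (I powr (1 / t) * g powr (1 - 1 / t)))"
      using M by (intro ennreal_mult[symmetric]) auto
    finally have "\<bar>u x\<bar> powr s \<le> M * d powr (s - ?n) * (I powr (1 / t) * g powr (1 - 1 / t))"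
      using M by simp
    then have "(\<bar>u x\<bar> powr s) powr t \<le> (M * d powr (s - ?n) * (I powr (1 / t) * g powr (1 - 1 / t))) powr t"
      using t by (intro powr_mono2) auto
    also have "\<dots> = M powr t * d powr ((s - ?n) * t) * I * g powr ((1 - 1 / t) * t)"
      using t I0 by (simp add: powr_mult powr_powr)
    also have "(s - ?n) * t = p - t * ?n" by (simp add: p_def algebra_simps)
    also have "(1 - 1 / t) * t = t - 1" using t by (simp add: field_simps)
    \<comment> \<open>Enlarging \<open>d\<close> to \<open>r\<close> is allowed because the exponent
      equals \<open>t\<close> times the positive difference of \<open>s\<close> and the
      dimension.\<close>
    also have "M powr t * d powr (p - t * ?n) * I * g powr (t - 1)
        \<le> M powr t * r powr (p - t * ?n) * I * g powr (t - 1)"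
      using d I0 s t by (intro mult_right_mono mult_left_mono powr_mono2) (auto simp: p_def mult.commute)
    finally show ?case by (simp add: powr_powr p_def \<kappa>_def mult_ac)
  qed
  \<comment> \<open>A vanishing energy would make \<open>u\<close> zero almost everywhere by the
    pointwise bound; hence \<open>I\<close> can be cancelled at the end.\<close>
  have "I \<noteq> 0"
  proof
    assume "I = 0"
    from bound have "AE x in lebesgue_on \<Omega>. u x = 0"
      by eventually_elim (simp add: \<open>I = 0\<close>)
    with nontriv show False ..
  qed
  have "ennreal I = (\<integral>\<^sup>+x. ennreal (w x * \<bar>u x\<bar> powr p) \<partial>lebesgue_on \<Omega>)" by (simp add: Iw)
  also have "\<dots> \<le> (\<integral>\<^sup>+x. ennreal (\<kappa> * I) * ennreal (w x) \<partial>lebesgue_on \<Omega>)"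
  proof (rule nn_integral_mono_AE)
    show "AE x in lebesgue_on \<Omega>. ennreal (w x * \<bar>u x\<bar> powr p) \<le> ennreal (\<kappa> * I) * ennreal (w x)"
      using bound w0
    proof eventually_elim
      case (elim x)
      then have "w x * \<bar>u x\<bar> powr p \<le> (\<kappa> * I) * w x"
        by (subst mult.commute) (intro mult_right_mono)
      then show ?case using \<kappa>0 I0 elim by (simp flip: ennreal_mult add: ennreal_leI)
    qed
  qed
  also have "\<dots> = ennreal (\<kappa> * I) * ennreal W"
    using measurable_restrict_space1[OF wm, of \<Omega>]
    by (simp add: nn_integral_cmult W(1)[symmetric] set_nn_integral_eq_lebesgue_on)
  finally have "I \<le> \<kappa> * I * W"
    using \<kappa>0 I0 W by (simp flip: ennreal_mult)
  then have "1 * I \<le> (\<kappa> * W) * I" by (simp add: mult_ac)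
  then have "1 \<le> \<kappa> * W"
    using I0 \<open>I \<noteq> 0\<close> by (intro mult_right_le_imp_le[of 1 I]) auto
  then show ?thesis by (simp add: \<kappa>_def p_def)
qed

section \<open>Infinite quantities and the choice of the constant\<close>

theorem theorem2p2:
  fixes p t :: real
  assumes "real CARD('n::finite) < p" and "1 < t" and "t < p / real CARD('n)"
  shows "\<exists>C::real. 0 < C \<and>
    (\<forall>(\<Omega>::(real^'n) set) v w u.
       open \<Omega> \<longrightarrow> v \<in> muckenhoupt t \<longrightarrow> w \<in> muckenhoupt t \<longrightarrow>
       u \<in> W1p0 p \<Omega> \<longrightarrow> \<not> (AE x in lebesgue_on \<Omega>. u x = 0) \<longrightarrow>
       weak_solution p \<Omega> v w u \<longrightarrow>
       1 \<le> ennreal C * epowr (inner_radius \<Omega>) (p - t * real CARD('n))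
             * epowr (dual_weight_sup t \<Omega> v (inner_radius \<Omega>)) (t - 1)
             * (\<integral>\<^sup>+z\<in>\<Omega>. ennreal (w z) \<partial>lebesgue))"
proof -
  let ?n = "real CARD('n)"
  have pt: "0 < p - t * ?n" and t1: "0 < t - 1" using assms by (simp_all add: field_simps)
  \<comment> \<open>The upper bound on \<open>t\<close> says exactly that \<open>s\<close> exceeds
    the dimension, as Morrey's inequality requires.\<close>
  define s where "s = p / t"
  have p: "p = s * t" using assms by (simp add: s_def)
  have s: "real DIM(real^'n) < s" using assms by (simp add: s_def field_simps)
  obtain M where M: "0 < M"
    and bound: "\<And>(\<Omega> :: (real^'n) set) u. open \<Omega> \<Longrightarrow> u \<in> W1p0 (s * t) \<Omega> \<Longrightarrow>
      AE x in lebesgue_on \<Omega>. \<forall>d\<ge>0. bdry_dist \<Omega> x = ennreal d \<longrightarrow>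
        ball x d \<subseteq> \<Omega> \<and>
        ennreal (\<bar>u x\<bar> powr s) \<le> ennreal (M * d powr (s - real DIM(real^'n))) *
          (\<integral>\<^sup>+z\<in>ball x d. ennreal (norm (wgrad \<Omega> u z) powr s) \<partial>lebesgue)"
    using W1p0_bdry_dist_bound[OF s assms(2)] by blast
  have "1 \<le> ennreal (M powr t) * epowr (inner_radius \<Omega>) (p - t * ?n)
      * epowr (dual_weight_sup t \<Omega> v (inner_radius \<Omega>)) (t - 1) * (\<integral>\<^sup>+z\<in>\<Omega>. ennreal (w z) \<partial>lebesgue)"
    if \<Omega>: "open \<Omega>" and v: "v \<in> muckenhoupt t" and w: "w \<in> muckenhoupt t"
      and u: "u \<in> W1p0 p \<Omega>" and nontriv: "\<not> (AE x in lebesgue_on \<Omega>. u x = 0)"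
      and sol: "weak_solution p \<Omega> v w u"
    for \<Omega> :: "(real^'n) set" and v w u
  proof -
    define r where "r = inner_radius \<Omega>"
    define g where "g = dual_weight_sup t \<Omega> v r"
    define W where "W = (\<integral>\<^sup>+z\<in>\<Omega>. ennreal (w z) \<partial>lebesgue)"
    \<comment> \<open>On an empty domain every function is zero almost everywhere.\<close>
    have ne: "\<Omega> \<noteq> {}" using nontriv by (auto simp: AE_restrict_space_iff)
    have pos: "0 < r" "0 < g" "0 < W"
      unfolding g_def W_def using inner_radius_pos[OF \<Omega> ne]
        muckenhoupt_nn_integral_open_pos[OF w assms(2) \<Omega> ne] dual_weight_sup_pos[OF v assms(2) ne]
      by (auto simp: r_def)
    have "1 \<le> ennreal (M powr t) * epowr r (p - t * ?n) * epowr g (t - 1) * W"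
    \<comment> \<open>All factors are positive, so a single infinite one makes the product infinite.
      This covers the whole space, whose inner radius is infinite.\<close>
    proof (cases "r = \<infinity> \<or> g = \<infinity> \<or> W = \<infinity>")
      case True
      have "0 < epowr r (p - t * ?n)" "0 < epowr g (t - 1)" "0 < ennreal (M powr t)"
        using pos M by (simp_all add: epowr_pos[OF pt] epowr_pos[OF t1])
      moreover have "epowr r (p - t * ?n) = \<infinity> \<or> epowr g (t - 1) = \<infinity> \<or> W = \<infinity>"
        using True epowr_top[OF pt] epowr_top[OF t1] by auto
      ultimately have "ennreal (M powr t) * epowr r (p - t * ?n) * epowr g (t - 1) * W = \<infinity>"
        using pos by (auto simp: ennreal_mult_eq_top_iff)
      then show ?thesis by simp
    next
      case False
      then obtain r' g' W' where eq: "r = ennreal r'" "g = ennreal g'" "W = ennreal W'"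
        and nn: "0 \<le> r'" "0 \<le> g'" "0 \<le> W'"
        by (metis ennreal_cases infinity_ennreal_def)
      have "1 \<le> M powr t * r' powr (p - t * ?n) * g' powr (t - 1) * W'"
        using weak_solution_inequality[OF s assms(2) M bound[OF \<Omega>] \<Omega> v w _ nontriv,
            folded p, OF u u sol, folded r_def, folded g_def, folded W_def, of r' g' W'] eq nn
        by simp
      then show ?thesis
        unfolding eq epowr_ennreal_pos[OF pt nn(1)] epowr_ennreal_pos[OF t1 nn(2)]
        using nn by (simp flip: ennreal_mult)
    qed
    then show ?thesis by (simp add: r_def g_def W_def)
  qed
  \<comment> \<open>The power \<open>t\<close> arises from raising the pointwise bound of order
    \<open>s\<close> to order \<open>p\<close>.\<close>
  then show ?thesis using M by (intro exI[of _ "M powr t"]) auto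
qed

end
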